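(* Let $N\ge 1$, let $T:\mathbb{R}_+^N\to\mathbb{R}_{++}^N$ be a continuous concave mapping, let $\|\cdot\|_a$ be a monotone norm on $\mathbb{R}^N$, and let $U:\mathbb{R}_{++}\to\mathbb{R}_{++}$ be the utility function associated with the canonical utility maximization problem for $T$ and $\|\cdot\|_a$. Assume that the lower bounding matrix $M$ of $T$ has spectral radius $\rho(M)>0$. Then $U(\bar p)\in\Theta(1)$ as $\bar p\to\infty$.
   Context: Notation: $\mathbb{R}_+=[0,\infty)$, $\mathbb{R}_{++}=(0,\infty)$; vector inequalities are entrywise; $e_j$ is the $j$th standard basis vector of $\mathbb{R}^N$. A mapping $T:\mathbb{R}_+^N\to\mathbb{R}^N$ is concave if $T(\alpha x+(1-\alpha)y)\ge \alpha T(x)+(1-\alpha)T(y)$ for all $x,y\in\mathbb{R}_+^N$, $\alpha\in(0,1)$. A norm $\|\cdot\|$ on $\mathbb{R}^N$ is monotone if for all $x,y\in\mathbb{R}_+^N$, $x\ge y$ implies $\|x\|\ge\|y\|$. Canonical utility maximization problem: given a power budget $\bar p\in\mathbb{R}_{++}$, maximize $c$ over $(p,c)\in\mathbb{R}_+^N\times\mathbb{R}_{++}$ subject to $p=cT(p)$ and $\|p\|_a\le\bar p$. It is known that for every $\bar p>0$ this problem has a unique solution $(p^\star_{\bar p},c^\star_{\bar p})\in\mathbb{R}_{++}^N\times\mathbb{R}_{++}$, and that it is also the unique pair satisfying $T(p)=\frac1c p$ and $\|p\|_a=\bar p$. The utility function is $U:\mathbb{R}_{++}\to\mathbb{R}_{++}$,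 $U(\bar p)=c^\star_{\bar p}$. Lower bounding matrix: for a continuous concave $T=[t_1,\ldots,t_N]:\mathbb{R}_+^N\to\mathbb{R}_{++}^N$, it is the matrix $M\in\mathbb{R}_+^{N\times N}$ with entries $[M]_{i,j}=\lim_{h\to0^+}h\,t_i(h^{-1}e_j)$ (the limits exist and are finite and non-negative). Theta notation: $f(x)\in\Theta(g(x))$ as $x\to\infty$ means that there exist $k_0,k_1,k_2\in\mathbb{R}_{++}$ such that $k_1g(x)\le f(x)\le k_2g(x)$ for all $x\ge k_0$; $\Theta(1)$ is the case where $g$ is a (positive) constant function. *)

theory Defs
  imports "HOL-Analysis.Analysis" "HOL-Library.Landau_Symbols"
begin

text \<open>
  Vectors live in \<open>real ^ 'n\<close>, where \<open>\<le>\<close> is the entrywise order (but \<open><\<close> is not the entrywise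
  strict order, so strict positivity is always spelled out componentwise).
  Mappings on the nonnegative orthant are total functions; their values outside it never matter.
\<close>

definition nonneg_orthant :: "(real ^ 'n) set" where
  "nonneg_orthant = {x. 0 \<le> x}"

definition concave_mapping :: "(real ^ 'n \<Rightarrow> real ^ 'n) \<Rightarrow> bool" where
  "concave_mapping T \<longleftrightarrow>
     (\<forall>x\<in>nonneg_orthant. \<forall>y\<in>nonneg_orthant. \<forall>\<alpha>\<in>{0<..<1::real}.
        \<alpha> *\<^sub>R T x + (1 - \<alpha>) *\<^sub>R T y \<le> T (\<alpha> *\<^sub>R x + (1 - \<alpha>) *\<^sub>R y))"

definition positive_mapping :: "(real ^ 'n \<Rightarrow> real ^ 'n) \<Rightarrow> bool" where
  "positive_mapping T \<longleftrightarrow> (\<forall>x\<in>nonneg_orthant. \<forall>i. 0 < T x $ i)"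

definition is_norm :: "('a::real_vector \<Rightarrow> real) \<Rightarrow> bool" where
  "is_norm \<nu> \<longleftrightarrow>
     (\<forall>x. 0 \<le> \<nu> x) \<and> (\<forall>x. \<nu> x = 0 \<longleftrightarrow> x = 0) \<and>
     (\<forall>a x. \<nu> (a *\<^sub>R x) = \<bar>a\<bar> * \<nu> x) \<and> (\<forall>x y. \<nu> (x + y) \<le> \<nu> x + \<nu> y)"

definition monotone_norm :: "(real ^ 'n \<Rightarrow> real) \<Rightarrow> bool" where
  "monotone_norm \<nu> \<longleftrightarrow> is_norm \<nu> \<and>
     (\<forall>x\<in>nonneg_orthant. \<forall>y\<in>nonneg_orthant. y \<le> x \<longrightarrow> \<nu> y \<le> \<nu> x)"

definition feasible ::
    "(real ^ 'n \<Rightarrow> real ^ 'n) \<Rightarrow> (real ^ 'n \<Rightarrow> real) \<Rightarrow> real \<Rightarrow> ((real ^ 'n) \<times> real) set" where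
  "feasible T \<nu> pbar = {(p, c). p \<in> nonneg_orthant \<and> 0 < c \<and> p = c *\<^sub>R T p \<and> \<nu> p \<le> pbar}"

definition solves_canonical_problem ::
    "(real ^ 'n \<Rightarrow> real ^ 'n) \<Rightarrow> (real ^ 'n \<Rightarrow> real) \<Rightarrow> real \<Rightarrow> real ^ 'n \<Rightarrow> real \<Rightarrow> bool" where
  "solves_canonical_problem T \<nu> pbar p c \<longleftrightarrow>
     is_arg_max snd (\<lambda>z. z \<in> feasible T \<nu> pbar) (p, c)"

text \<open>Only meaningful for \<open>pbar > 0\<close>, where the canonical problem has a unique solution.\<close>

definition utility ::
    "(real ^ 'n \<Rightarrow> real ^ 'n) \<Rightarrow> (real ^ 'n \<Rightarrow> real) \<Rightarrow> real \<Rightarrow> real" where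
  "utility T \<nu> pbar = (THE c. \<exists>p. solves_canonical_problem T \<nu> pbar p c)"

definition lower_bounding_matrix :: "(real ^ 'n \<Rightarrow> real ^ 'n) \<Rightarrow> real ^ 'n ^ 'n" where
  "lower_bounding_matrix T =
     (\<chi> i j. Lim (at_right 0) (\<lambda>h. h * T (inverse h *\<^sub>R axis j 1) $ i))"

definition spectrum :: "complex ^ 'n ^ 'n \<Rightarrow> complex set" where
  "spectrum A = {k. \<exists>v. v \<noteq> 0 \<and> A *v v = k *s v}"

text \<open>The spectral radius of a real matrix takes all its complex eigenvalues into account.\<close>

definition spectral_radius :: "real ^ 'n ^ 'n \<Rightarrow> real" where
  "spectral_radius A = Max (cmod ` spectrum (map_matrix complex_of_real A))"

end

theory Submission
  imports Defs "HOL-Computational_Algebra.Fundamental_Theorem_Algebra"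
begin

text \<open>
  Feasible sets grow with the budget, so the utility is nondecreasing, and it is positive because the
  problem is solvable; this bounds it from below. By concavity \<open>T p \<ge> M p\<close>, so a feasible pair
  satisfies \<open>p \<ge> c M p\<close> with \<open>p > 0\<close>, which forces \<open>c \<le> 1 / \<rho>(M)\<close> whatever the budget.
\<close>

subsection \<open>Complex eigenvalues\<close>

text \<open>Evaluation at \<open>x\<close> is a ring homomorphism and a determinant is a signed sum
  of products of entries. This lets characteristic polynomials be handled as determinants of
  matrices of polynomials.\<close>

lemma poly_det:
  fixes A :: "('a::comm_ring_1 poly) ^ 'n ^ 'n"
  shows "poly (det A) x = det (\<chi> i j. poly (A $ i $ j) x)"
proof -
  have "poly (of_int k :: 'a poly) x = of_int k" for k
    by (simp add: of_int_poly)
  then show ?thesis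
    by (simp add: det_def poly_sum poly_prod)
qed

lemma in_spectrum_iff_det: "k \<in> spectrum A \<longleftrightarrow> det (mat k - A) = 0"
proof -
  have *: "(mat k - A) *v v = k *s v - A *v v" for v
  proof -
    have "mat k *v v = k *s v"
      by (simp add: vec_eq_iff matrix_vector_mult_def mat_def if_distrib[of "\<lambda>x. x * _"] cong: if_cong)
    then show ?thesis
      by (simp add: matrix_vector_mult_diff_rdistrib)
  qed
  have "det (mat k - A) = 0 \<longleftrightarrow> (\<exists>v. v \<noteq> 0 \<and> (mat k - A) *v v = 0)"
    using matrix_left_invertible_ker[of "mat k - A"]
    by (auto simp: invertible_left_inverse[symmetric] invertible_det_nz)
  also have "\<dots> \<longleftrightarrow> k \<in> spectrum A"
    by (auto simp: spectrum_def *)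
  finally show ?thesis ..
qed

text \<open>Makes the \<open>Max\<close> in \<open>spectral_radius\<close> meaningful. Eigenvalues
  are the roots of the characteristic polynomial, so it remains to see that this polynomial is not
  constant; comparison with its reversal takes the place of a degree computation.\<close>

lemma spectrum_finite_nonempty:
  fixes A :: "complex ^ 'n ^ 'n"
  shows "finite (spectrum A)" "spectrum A \<noteq> {}"
proof -
  define p :: "complex poly"
    where "p = det (\<chi> i j. [:- A $ i $ j, if i = j then 1 else 0:])"
  \<comment> \<open>\<open>q\<close> is det (I - z A), the reversal of the characteristic polynomial
    \<open>p\<close>.\<close>
  define q :: "complex poly"
    where "q = det (\<chi> i j. [:if i = j then 1 else 0, - A $ i $ j:])"
  have p: "poly p k = det (mat k - A)" for k
    unfolding p_def poly_det by (rule arg_cong[where f = det]) (simp add: vec_eq_iff mat_def)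
  have q: "poly q z = z ^ CARD('n) * poly p (1 / z)" if "z \<noteq> 0" for z
  proof -
    have "poly q z = det (\<chi> i. z *s (mat (1 / z) - A) $ i)"
      unfolding q_def poly_det
      by (rule arg_cong[where f = det]) (use that in \<open>simp add: vec_eq_iff mat_def algebra_simps\<close>)
    also have "\<dots> = z ^ CARD('n) * det (\<chi> i. (mat (1 / z) - A) $ i)"
      unfolding det_rows_mul by simp
    also have "(\<chi> i. (mat (1 / z) - A) $ i) = mat (1 / z) - A"
      by (rule vec_lambda_eta)
    finally show ?thesis
      by (simp add: p)
  qed
  have q0: "poly q 0 = 1"
  proof -
    have "poly q 0 = det (mat 1 :: complex ^ 'n ^ 'n)"
      unfolding q_def poly_det by (rule arg_cong[where f = det]) (simp add: vec_eq_iff mat_def)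
    then show ?thesis
      by simp
  qed
  have nonconst: "\<not> constant (poly p)"
  proof
    assume "constant (poly p)"
    then have c: "poly p x = poly p 0" for x
      unfolding constant_def by blast
    \<comment> \<open>For constant \<open>p\<close>, \<open>q\<close> agrees with a multiple of z^N
      at infinitely many points, hence as a polynomial. As N \<ge> 1 it then vanishes at 0, against
      \<open>q0\<close>.\<close>
    have "UNIV - {0} \<subseteq> {z. poly (q - monom (poly p 0) CARD('n)) z = 0}"
      using q c by (auto simp: poly_monom)
    moreover have "infinite (UNIV - {0::complex})"
      by (simp add: infinite_UNIV_char_0)
    ultimately have "q - monom (poly p 0) CARD('n) = 0"
      using poly_roots_finite finite_subset by blast
    then have "poly q 0 = 0"
      by (simp add: poly_monom)
    with q0 show False
      by simp
  qed
  have spec: "spectrum A = {k. poly p k = 0}"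
    using in_spectrum_iff_det by (auto simp: p)
  have "p \<noteq> 0"
    using nonconst by (auto simp: constant_def)
  then show "finite (spectrum A)"
    by (simp add: spec poly_roots_finite)
  show "spectrum A \<noteq> {}"
    using fundamental_theorem_of_algebra[OF nonconst] by (auto simp: spec)
qed

lemma spectral_radius_attained:
  fixes A :: "real ^ 'n ^ 'n"
  obtains k v where "v \<noteq> 0" "map_matrix complex_of_real A *v v = k *s v" "cmod k = spectral_radius A"
proof -
  have "spectral_radius A \<in> cmod ` spectrum (map_matrix complex_of_real A)"
    unfolding spectral_radius_def by (intro Max_in) (auto simp: spectrum_finite_nonempty)
  then show ?thesis
    using that by (auto simp: spectrum_def)
qed

text \<open>Compare \<open>\<bar>v\<bar>\<close>, for an eigenvector \<open>v\<close> of an eigenvalue of maximal modulus, with the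
  smallest multiple of \<open>x\<close> that dominates it.\<close>

lemma spectral_radius_le_of_supersolution:
  fixes A :: "real ^ 'n ^ 'n" and x :: "real ^ 'n"
  assumes A: "\<And>i j. 0 \<le> A $ i $ j" and x: "\<And>i. 0 < x $ i"
    and le: "\<And>i. (A *v x) $ i \<le> r * x $ i"
  shows "spectral_radius A \<le> r"
proof -
  obtain k v where v: "v \<noteq> 0" and eig: "map_matrix complex_of_real A *v v = k *s v"
    and k: "cmod k = spectral_radius A"
    by (rule spectral_radius_attained)
  define t where "t = Max (range (\<lambda>i. cmod (v $ i) / x $ i))"
  have t_ge: "cmod (v $ i) \<le> t * x $ i" for i
  proof -
    have "cmod (v $ i) / x $ i \<le> t"
      unfolding t_def by (intro Max_ge) auto
    then show ?thesis
      using x[of i] by (simp add: divide_le_eq)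
  qed
  have "t \<in> range (\<lambda>i. cmod (v $ i) / x $ i)"
    unfolding t_def by (intro Max_in) auto
  then obtain m where "t = cmod (v $ m) / x $ m"
    by blast
  then have m: "cmod (v $ m) = t * x $ m"
    using x[of m] by simp
  obtain i where "v $ i \<noteq> 0"
    using v by (auto simp: vec_eq_iff)
  then have "0 < t * x $ i"
    using t_ge[of i] by (smt (verit) zero_less_norm_iff)
  then have t: "0 < t"
    using x[of i] by (simp add: zero_less_mult_iff)
  \<comment> \<open>Row \<open>m\<close> is the one where the domination of \<open>v\<close> by
    \<open>t\<close> times \<open>x\<close> is an equality, so \<open>t * x $ m\<close> > 0 can be
    cancelled at the end.\<close>
  have "cmod k * (t * x $ m) = cmod ((map_matrix complex_of_real A *v v) $ m)"
    by (simp add: eig norm_mult m)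
  also have "\<dots> \<le> (\<Sum>j\<in>UNIV. cmod (complex_of_real (A $ m $ j) * v $ j))"
    by (simp add: matrix_vector_mult_def map_matrix_def norm_sum)
  also have "\<dots> \<le> (\<Sum>j\<in>UNIV. A $ m $ j * (t * x $ j))"
    by (intro sum_mono) (auto simp: norm_mult A t_ge intro!: mult_left_mono)
  also have "\<dots> = t * (A *v x) $ m"
    by (simp add: matrix_vector_mult_def sum_distrib_left algebra_simps)
  also have "\<dots> \<le> t * (r * x $ m)"
    using le t by (intro mult_left_mono) auto
  finally show ?thesis
    using t x[of m] k by (simp add: mult.left_commute[of _ t] mult_le_cancel_left_pos mult_le_cancel_right_pos)
qed

subsection \<open>The lower bounding matrix\<close>

lemma nonneg_orthant_iff: "x \<in> nonneg_orthant \<longleftrightarrow> (\<forall>i. 0 \<le> x $ i)"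
  by (simp add: nonneg_orthant_def less_eq_vec_def)

lemma convex_nonneg_orthant: "convex nonneg_orthant"
  by (rule convexI) (auto simp: nonneg_orthant_iff)

lemma closed_nonneg_orthant: "closed (nonneg_orthant :: (real ^ 'n) set)"
proof -
  have "nonneg_orthant = {x::real ^ 'n. \<forall>i. 0 \<le> x $ i}"
    by (auto simp: nonneg_orthant_iff)
  then show ?thesis
    by (metis closed_positive_orthant)
qed

lemma concave_mapping_component:
  assumes "concave_mapping T"
  shows "concave_on nonneg_orthant (\<lambda>x. T x $ i)"
  unfolding concave_on_def
proof (intro convex_onI convex_nonneg_orthant)
  fix t :: real and x y :: "real ^ 'a"
  assume "0 < t" "t < 1" "x \<in> nonneg_orthant" "y \<in> nonneg_orthant"
  then have "(1 - t) *\<^sub>R T x + (1 - (1 - t)) *\<^sub>R T y \<le> T ((1 - t) *\<^sub>R x + (1 - (1 - t)) *\<^sub>R y)"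
    using assms unfolding concave_mapping_def by (metis diff_gt_0_iff_gt diff_less_eq greaterThanLessThan_iff less_add_same_cancel1)
  then show "- T ((1 - t) *\<^sub>R x + t *\<^sub>R y) $ i \<le> (1 - t) * - T x $ i + t * - T y $ i"
    by (simp add: less_eq_vec_def algebra_simps)
qed

lemma concave_perspective_mono:
  fixes f :: "real ^ 'n \<Rightarrow> real"
  assumes f: "concave_on nonneg_orthant f" and "0 \<le> f 0" and x: "x \<in> nonneg_orthant"
    and h: "0 < h" "h \<le> h'"
  shows "h * f (inverse h *\<^sub>R x) \<le> h' * f (inverse h' *\<^sub>R x)"
proof -
  have eq: "(h / h') *\<^sub>R (inverse h *\<^sub>R x) + (1 - h / h') *\<^sub>R 0 = inverse h' *\<^sub>R x"
    using h by (simp add: divide_inverse)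
  have "(h / h') * f (inverse h *\<^sub>R x) + (1 - h / h') * f 0
      \<le> f ((h / h') *\<^sub>R (inverse h *\<^sub>R x) + (1 - h / h') *\<^sub>R 0)"
    using x h by (intro concave_on_iff[THEN iffD1, OF f, THEN conjunct2, rule_format])
      (auto simp: nonneg_orthant_iff)
  moreover have "0 \<le> (1 - h / h') * f 0"
    using h \<open>0 \<le> f 0\<close> by auto
  ultimately have "(h / h') * f (inverse h *\<^sub>R x) \<le> f (inverse h' *\<^sub>R x)"
    unfolding eq by linarith
  then show ?thesis
    using h by (simp add: field_simps)
qed

lemma mono_tendsto_Inf_at_right:
  fixes g :: "real \<Rightarrow> real"
  assumes mono: "\<And>x y. a < x \<Longrightarrow> x \<le> y \<Longrightarrow> g x \<le> g y" and bdd: "bdd_below (g ` {a<..})"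
  shows "(g \<longlongrightarrow> Inf (g ` {a<..})) (at_right a)"
proof (rule order_tendstoI)
  fix y assume "y < Inf (g ` {a<..})"
  then have "y < g x" if "a < x" for x
    using cInf_lower[OF _ bdd, of "g x"] that by force
  then show "eventually (\<lambda>x. y < g x) (at_right a)"
    by (simp add: eventually_at_filter)
next
  fix y assume "Inf (g ` {a<..}) < y"
  then obtain b where b: "a < b" "g b < y"
    by (subst (asm) cInf_less_iff[OF _ bdd]) auto
  then have "g x < y" if "a < x" "x < b" for x
    using mono[of x b] that by simp
  then show "eventually (\<lambda>x. g x < y) (at_right a)"
    unfolding eventually_at_right[OF b(1)] using b(1) by blast
qed

context
  fixes T :: "real ^ 'n \<Rightarrow> real ^ 'n"
  assumes conc: "concave_mapping T" and pos: "positive_mapping T"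
begin

text \<open>The scaled function is monotone in \<open>h\<close> and bounded below by 0, so the limit
  behind \<open>Lim\<close> exists and equals the infimum. The infimum gives bounds valid at every h
  > 0, not only in the limit.\<close>

lemma lower_bounding_matrix_eq_Inf:
  "lower_bounding_matrix T $ i $ j = Inf ((\<lambda>h. h * T (inverse h *\<^sub>R axis j 1) $ i) ` {0<..})"
  and bdd_below_scaled:
  "bdd_below ((\<lambda>h. h * T (inverse h *\<^sub>R axis j 1) $ i) ` {0<..})"
proof -
  have T0: "0 < T 0 $ i"
    using pos by (simp add: positive_mapping_def nonneg_orthant_iff)
  show bdd: "bdd_below ((\<lambda>h. h * T (inverse h *\<^sub>R axis j 1) $ i) ` {0<..})"
    using pos by (intro bdd_belowI[of _ 0])
      (auto simp: positive_mapping_def nonneg_orthant_iff axis_def intro!: mult_nonneg_nonneg less_imp_le)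
  have "((\<lambda>h. h * T (inverse h *\<^sub>R axis j 1) $ i) \<longlongrightarrow>
      Inf ((\<lambda>h. h * T (inverse h *\<^sub>R axis j 1) $ i) ` {0<..})) (at_right 0)"
    using T0 by (intro mono_tendsto_Inf_at_right bdd
        concave_perspective_mono[OF concave_mapping_component[OF conc]])
      (auto simp: nonneg_orthant_iff axis_def)
  then show "lower_bounding_matrix T $ i $ j = Inf ((\<lambda>h. h * T (inverse h *\<^sub>R axis j 1) $ i) ` {0<..})"
    by (simp add: lower_bounding_matrix_def tendsto_Lim)
qed

lemma lower_bounding_matrix_nonneg: "0 \<le> lower_bounding_matrix T $ i $ j"
  unfolding lower_bounding_matrix_eq_Inf
  using pos by (intro cInf_greatest)
    (auto simp: positive_mapping_def nonneg_orthant_iff axis_def intro!: mult_nonneg_nonneg less_imp_le)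

lemma lower_bounding_matrix_le:
  assumes "0 < h"
  shows "lower_bounding_matrix T $ i $ j \<le> h * T (inverse h *\<^sub>R axis j 1) $ i"
  unfolding lower_bounding_matrix_eq_Inf using assms by (intro cInf_lower bdd_below_scaled) auto

text \<open>Jensen's inequality, writing \<open>x\<close> as the convex combination of the points \<open>s e\<^sub>j\<close> with weights
  \<open>x\<^sub>j / s\<close>, where \<open>s\<close> is the sum of the entries of \<open>x\<close>.\<close>

lemma lower_bounding_matrix_mult_le:
  assumes x: "x \<in> nonneg_orthant"
  shows "(lower_bounding_matrix T *v x) $ i \<le> T x $ i"
proof (cases "x = 0")
  case True
  then show ?thesis
    using pos x by (simp add: positive_mapping_def less_imp_le)
next
  case False
  define s where "s = (\<Sum>j\<in>UNIV. x $ j)"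
  have x0: "0 \<le> x $ j" for j
    using x by (simp add: nonneg_orthant_iff)
  obtain j where "x $ j \<noteq> 0"
    using False by (auto simp: vec_eq_iff)
  then have s: "0 < s"
    unfolding s_def using x0 by (intro sum_pos2[of _ j]) (auto simp: less_le)
  have "(lower_bounding_matrix T *v x) $ i = (\<Sum>j\<in>UNIV. x $ j * lower_bounding_matrix T $ i $ j)"
    by (simp add: matrix_vector_mult_def mult.commute)
  \<comment> \<open>The choice h = 1 / s places every evaluation point at s e_j, the points used in
    Jensen's inequality.\<close>
  also have "\<dots> \<le> (\<Sum>j\<in>UNIV. x $ j * (inverse s * T (inverse (inverse s) *\<^sub>R axis j 1) $ i))"
    using s x0 by (intro sum_mono mult_left_mono lower_bounding_matrix_le) auto
  also have "\<dots> = (\<Sum>j\<in>UNIV. (x $ j / s) * T (s *\<^sub>R axis j 1) $ i)"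
    by (simp add: field_simps)
  also have "\<dots> \<le> T (\<Sum>j\<in>UNIV. (x $ j / s) *\<^sub>R (s *\<^sub>R axis j 1)) $ i"
  proof (rule concave_on_sum[OF _ _ concave_mapping_component[OF conc]])
    show "(\<Sum>j\<in>UNIV. x $ j / s) = 1"
      using s by (simp add: s_def flip: sum_divide_distrib)
  qed (use s x0 in \<open>auto simp: nonneg_orthant_iff axis_def\<close>)
  also have "(\<Sum>j\<in>UNIV. (x $ j / s) *\<^sub>R (s *\<^sub>R axis j 1)) = x"
    using s basis_expansion[of x] by (simp add: scalar_mult_eq_scaleR)
  finally show ?thesis .
qed

end

subsection \<open>Solvability of the canonical problem\<close>

lemma is_norm_convex_on: "is_norm \<nu> \<Longrightarrow> convex_on UNIV \<nu>"
  unfolding is_norm_def by (intro convex_onI) (smt (verit) convex_UNIV)+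

text \<open>A convex function on an open subset of a Euclidean space is continuous.\<close>

lemma is_norm_continuous_on:
  fixes \<nu> :: "'a::euclidean_space \<Rightarrow> real"
  assumes "is_norm \<nu>"
  shows "continuous_on S \<nu>"
  using convex_on_continuous[OF open_UNIV is_norm_convex_on[OF assms]] continuous_on_subset by blast

text \<open>\<open>m\<close> is the minimum of \<open>\<nu>\<close> on the Euclidean unit sphere;
  homogeneity extends the bound to all vectors. It makes the balls of \<open>\<nu>\<close> bounded,
  hence compact.\<close>

lemma is_norm_lower_bound:
  fixes \<nu> :: "'a::euclidean_space \<Rightarrow> real"
  assumes \<nu>: "is_norm \<nu>"
  obtains m where "0 < m" "\<And>x. m * norm x \<le> \<nu> x"
proof -
  have "sphere (0::'a) 1 \<noteq> {}"
    by simp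
  then obtain z where z: "norm z = 1" and min: "\<And>y. norm y = 1 \<Longrightarrow> \<nu> z \<le> \<nu> y"
    using continuous_attains_inf[OF compact_sphere _ is_norm_continuous_on[OF \<nu>], of 0 1] by auto
  have "0 < \<nu> z"
    using \<nu> z unfolding is_norm_def by (metis norm_zero order_le_less zero_neq_one)
  moreover have "\<nu> z * norm x \<le> \<nu> x" for x
  proof (cases "x = 0")
    case True
    then show ?thesis
      using \<nu> by (simp add: is_norm_def)
  next
    case False
    have "\<nu> z \<le> \<nu> (inverse (norm x) *\<^sub>R x)"
      using False by (intro min) simp
    also have "\<dots> = inverse (norm x) * \<nu> x"
      using \<nu> by (simp add: is_norm_def)
    finally show ?thesis
      using False by (simp add: field_simps)
  qed
  ultimately show ?thesis
    by (rule that)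
qed

lemma compact_nonneg_norm_ball:
  fixes \<nu> :: "real ^ 'n \<Rightarrow> real"
  assumes \<nu>: "is_norm \<nu>"
  shows "compact {x \<in> nonneg_orthant. \<nu> x \<le> r}"
proof -
  obtain m where m: "0 < m" "\<And>x. m * norm x \<le> \<nu> x"
    using is_norm_lower_bound[OF \<nu>] by blast
  have "norm x \<le> r / m" if "\<nu> x \<le> r" for x
    using m(2)[of x] m(1) that by (simp add: field_simps)
  then have "bounded {x \<in> nonneg_orthant. \<nu> x \<le> r}"
    by (auto intro: boundedI)
  moreover have "closed ({x. \<nu> x \<le> r} \<inter> nonneg_orthant)"
    by (intro closed_Int closed_nonneg_orthant closed_Collect_le is_norm_continuous_on[OF \<nu>] continuous_on_const)
  moreover have "{x. \<nu> x \<le> r} \<inter> nonneg_orthant = {x \<in> nonneg_orthant. \<nu> x \<le> r}"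
    by auto
  ultimately show ?thesis
    by (simp add: compact_eq_bounded_closed)
qed

lemma convex_nonneg_norm_ball:
  assumes "is_norm \<nu>"
  shows "convex {x \<in> nonneg_orthant. \<nu> x \<le> r}"
proof -
  have "\<nu> (u *\<^sub>R x + v *\<^sub>R y) \<le> r"
    if "\<nu> x \<le> r" "\<nu> y \<le> r" "0 \<le> u" "0 \<le> v" "u + v = 1" for x y u v
  proof -
    have "\<nu> (u *\<^sub>R x + v *\<^sub>R y) \<le> u * \<nu> x + v * \<nu> y"
      using is_norm_convex_on[OF assms] that by (simp add: convex_on_def)
    also have "\<dots> \<le> r"
      using that by (intro convex_bound_le)
    finally show ?thesis .
  qed
  then show ?thesis
    using convex_nonneg_orthant by (auto simp: convex_def)
qed

context
  fixes T :: "real ^ 'n \<Rightarrow> real ^ 'n" and \<nu> :: "real ^ 'n \<Rightarrow> real" and r :: real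
  assumes cont: "continuous_on nonneg_orthant T" and pos: "positive_mapping T"
    and \<nu>: "is_norm \<nu>" and r: "0 < r"
begin

lemma zero_in_nonneg_norm_ball: "0 \<in> {x \<in> nonneg_orthant. \<nu> x \<le> r}"
proof -
  have "\<nu> 0 = 0"
    using \<nu> unfolding is_norm_def by blast
  then show ?thesis
    using r by (simp add: nonneg_orthant_iff)
qed

text \<open>For small \<open>c\<close> the map \<open>c T\<close> sends the compact convex set of admissible powers into itself, so
  Brouwer's theorem applies.\<close>

lemma feasible_nonempty: "feasible T \<nu> r \<noteq> {}"
proof -
  let ?K = "{x \<in> nonneg_orthant. \<nu> x \<le> r}"
  have contK: "continuous_on ?K T"
    by (rule continuous_on_subset[OF cont]) auto
  have "continuous_on ?K (\<lambda>x. \<nu> (T x))"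
    by (rule continuous_on_compose2[OF is_norm_continuous_on[OF \<nu>, of UNIV] contK]) auto
  then obtain B where B: "\<And>x. x \<in> ?K \<Longrightarrow> \<nu> (T x) \<le> B"
    using continuous_attains_sup[OF compact_nonneg_norm_ball[OF \<nu>], of r "\<lambda>x. \<nu> (T x)"]
      zero_in_nonneg_norm_ball by blast
  \<comment> \<open>Chosen so that \<open>c * max B 1 = r\<close>; the maximum with 1 keeps the
    divisor positive.\<close>
  define c where "c = r / max B 1"
  have c: "0 < c"
    using r by (simp add: c_def)
  have self: "c *\<^sub>R T x \<in> ?K" if x: "x \<in> ?K" for x
  proof -
    have "\<nu> (c *\<^sub>R T x) = c * \<nu> (T x)"
      using \<nu> c by (simp add: is_norm_def)
    also have "\<dots> \<le> c * max B 1"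
      using c B[OF x] by (intro mult_left_mono) auto
    also have "\<dots> = r"
      by (simp add: c_def)
    finally show ?thesis
      using x c pos by (auto simp: nonneg_orthant_iff positive_mapping_def intro!: mult_nonneg_nonneg less_imp_le)
  qed
  obtain p where "p \<in> ?K" "c *\<^sub>R T p = p"
  proof (rule brouwer[of ?K "\<lambda>x. c *\<^sub>R T x"])
    show "?K \<noteq> {}"
      using zero_in_nonneg_norm_ball by blast
  qed (use self in \<open>auto intro!: compact_nonneg_norm_ball convex_nonneg_norm_ball \<nu> continuous_intros contK\<close>)
  then have "(p, c) \<in> feasible T \<nu> r"
    using c by (simp add: feasible_def)
  then show ?thesis
    by blast
qed

text \<open>A continuous function attains its maximum on a compact set. Since 0 < c is not a closed
  condition, the search is restricted to pairs whose \<open>c\<close> is at least that of one known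
  feasible pair; this discards only smaller values.\<close>

lemma canonical_problem_solvable: "\<exists>p c. solves_canonical_problem T \<nu> r p c"
proof -
  let ?K = "{x \<in> nonneg_orthant. \<nu> x \<le> r}"
  have contK: "continuous_on ?K T"
    by (rule continuous_on_subset[OF cont]) auto
  obtain p0 c0 where feas0: "(p0, c0) \<in> feasible T \<nu> r"
    using feasible_nonempty by auto
  then have c0: "0 < c0"
    by (simp add: feasible_def)
  fix i :: 'n
  have Tpos: "0 < T p $ i" if "p \<in> ?K" for p
    using that pos by (simp add: positive_mapping_def)
  \<comment> \<open>Any single coordinate of p = c T(p) determines \<open>c\<close> as this
    quotient, which is bounded on the compact set \<open>?K\<close>.\<close>
  have "continuous_on ?K (\<lambda>p. p $ i / T p $ i)"
    using Tpos by (intro continuous_intros contK) fastforce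
  then obtain C where C: "\<And>p. p \<in> ?K \<Longrightarrow> p $ i / T p $ i \<le> C"
    using continuous_attains_sup[OF compact_nonneg_norm_ball[OF \<nu>], of r "\<lambda>p. p $ i / T p $ i"]
      zero_in_nonneg_norm_ball by blast
  have bound: "c \<le> C" if "(p, c) \<in> feasible T \<nu> r" for p c
  proof -
    have "p \<in> ?K" and "p $ i = c * T p $ i"
      using that by (auto simp: feasible_def vec_eq_iff)
    then show ?thesis
      using C[of p] Tpos[of p] by simp
  qed
  let ?F = "{z \<in> ?K \<times> {c0..C}. fst z = snd z *\<^sub>R T (fst z)}"
  have feasible_iff: "z \<in> ?F \<longleftrightarrow> z \<in> feasible T \<nu> r \<and> c0 \<le> snd z" for z
    using bound[of "fst z" "snd z"] c0 by (cases z) (auto simp: feasible_def)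
  have comp: "compact (?K \<times> {c0..C})"
    by (intro compact_Times compact_nonneg_norm_ball \<nu> compact_Icc)
  have "continuous_on (?K \<times> {c0..C}) (\<lambda>z. fst z - snd z *\<^sub>R T (fst z))"
    by (intro continuous_intros continuous_on_compose2[OF contK]) auto
  then have "closed ((?K \<times> {c0..C}) \<inter> (\<lambda>z. fst z - snd z *\<^sub>R T (fst z)) -` {0})"
    by (intro continuous_closed_preimage compact_imp_closed[OF comp]) auto
  then have "compact ((?K \<times> {c0..C}) \<inter> ((?K \<times> {c0..C}) \<inter> (\<lambda>z. fst z - snd z *\<^sub>R T (fst z)) -` {0}))"
    by (rule compact_Int_closed[OF comp])
  also have "(?K \<times> {c0..C}) \<inter> ((?K \<times> {c0..C}) \<inter> (\<lambda>z. fst z - snd z *\<^sub>R T (fst z)) -` {0}) = ?F"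
    by (intro set_eqI) (simp only: Int_iff vimage_singleton_eq mem_Collect_eq right_minus_eq
        conj_assoc[symmetric] conj_absorb)
  finally have "compact ?F" .
  moreover have "(p0, c0) \<in> ?F"
    using feas0 by (simp only: feasible_iff) simp
  ultimately obtain z where z: "z \<in> ?F" and max: "\<And>y. y \<in> ?F \<Longrightarrow> snd y \<le> snd z"
    using continuous_attains_sup[of ?F snd] continuous_on_snd[OF continuous_on_id] by blast
  have "snd y \<le> snd z" if "y \<in> feasible T \<nu> r" for y
  proof (cases "c0 \<le> snd y")
    case True
    with that show ?thesis
      using max[of y] unfolding feasible_iff by blast
  next
    case False
    then show ?thesis
      using z unfolding feasible_iff by linarith
  qed
  moreover have "z \<in> feasible T \<nu> r"
    using z unfolding feasible_iff by blast
  ultimately have "solves_canonical_problem T \<nu> r (fst z) (snd z)"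
    by (simp add: solves_canonical_problem_def is_arg_max_linorder)
  then show ?thesis
    by blast
qed

text \<open>The description in \<open>utility\<close> ranges over \<open>c\<close> alone, and two
  maximal values of \<open>c\<close> are equal by antisymmetry.\<close>

lemma utility_attained:
  obtains p where "solves_canonical_problem T \<nu> r p (utility T \<nu> r)"
proof -
  have "\<exists>!c. \<exists>p. solves_canonical_problem T \<nu> r p c"
    using canonical_problem_solvable
    by (auto simp: solves_canonical_problem_def is_arg_max_linorder intro!: antisym)
  then have "\<exists>p. solves_canonical_problem T \<nu> r p (utility T \<nu> r)"
    unfolding utility_def by (rule theI')
  then show ?thesis
    using that by blast
qed

lemma utility_feasible: obtains p where "(p, utility T \<nu> r) \<in> feasible T \<nu> r"
  using utility_attained by (metis solves_canonical_problem_def is_arg_max_linorder)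

lemma le_utility: "(p, c) \<in> feasible T \<nu> r \<Longrightarrow> c \<le> utility T \<nu> r"
  using utility_attained by (metis solves_canonical_problem_def is_arg_max_linorder snd_conv)

end

section \<open>Bounds on the utility that are uniform in the budget\<close>

lemma feasible_utility_bound:
  assumes conc: "concave_mapping T" and pos: "positive_mapping T"
    and rho: "0 < spectral_radius (lower_bounding_matrix T)"
    and pc: "(p, c) \<in> feasible T \<nu> r"
  shows "c \<le> 1 / spectral_radius (lower_bounding_matrix T)"
proof -
  have p: "p \<in> nonneg_orthant" and c: "0 < c" and eq: "p = c *\<^sub>R T p"
    using pc by (auto simp: feasible_def)
  have T: "T p $ i = 1 / c * p $ i" for i
    using arg_cong[OF eq, of "\<lambda>x. x $ i"] c by (simp add: field_simps)
  have "spectral_radius (lower_bounding_matrix T) \<le> 1 / c"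
  \<comment> \<open>\<open>p\<close> is an admissible comparison vector: its entries are positive
    because p = c T(p) and \<open>T\<close> is positive.\<close>
  proof (rule spectral_radius_le_of_supersolution[of _ p])
    fix i
    show "(lower_bounding_matrix T *v p) $ i \<le> 1 / c * p $ i"
      using lower_bounding_matrix_mult_le[OF conc pos p, of i] unfolding T .
    have "0 < T p $ i"
      using pos p by (simp add: positive_mapping_def)
    then show "0 < p $ i"
      using c by (simp add: T zero_less_divide_iff)
  qed (rule lower_bounding_matrix_nonneg[OF conc pos])
  then show ?thesis
    using c rho by (simp add: field_simps)
qed

theorem corollary1:
  fixes T :: "real ^ 'n \<Rightarrow> real ^ 'n"
    and \<nu> :: "real ^ 'n \<Rightarrow> real"
  assumes "continuous_on nonneg_orthant T"
    and "concave_mapping T"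
    and "positive_mapping T"
    and "monotone_norm \<nu>"
    and "spectral_radius (lower_bounding_matrix T) > 0"
  shows "(\<lambda>pbar::real. utility T \<nu> pbar) \<in> \<Theta>(\<lambda>_. 1)"
proof -
  have \<nu>: "is_norm \<nu>"
    using assms(4) by (simp add: monotone_norm_def)
  note ctx = assms(1,3) \<nu>
  obtain p where p: "(p, utility T \<nu> 1) \<in> feasible T \<nu> 1"
    by (rule utility_feasible[OF ctx zero_less_one])
  then have pos: "0 < utility T \<nu> 1"
    by (simp add: feasible_def)
  \<comment> \<open>Budget 1 is an arbitrary reference point: its optimal pair stays feasible for
    every larger budget, so its value serves as the lower constant.\<close>
  have bounds: "utility T \<nu> 1 \<le> utility T \<nu> r \<and>
      utility T \<nu> r \<le> 1 / spectral_radius (lower_bounding_matrix T)" if "1 \<le> r" for r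
  proof
    have r: "0 < r"
      using that by simp
    have "(p, utility T \<nu> 1) \<in> feasible T \<nu> r"
      using p that by (auto simp: feasible_def)
    then show "utility T \<nu> 1 \<le> utility T \<nu> r"
      by (rule le_utility[OF ctx r])
    obtain q where "(q, utility T \<nu> r) \<in> feasible T \<nu> r"
      by (rule utility_feasible[OF ctx r])
    then show "utility T \<nu> r \<le> 1 / spectral_radius (lower_bounding_matrix T)"
      by (rule feasible_utility_bound[OF assms(2,3,5)])
  qed
  show ?thesis
  proof (rule bigthetaI'[OF pos, of "1 / spectral_radius (lower_bounding_matrix T)"])
    show "eventually (\<lambda>r. utility T \<nu> 1 * norm (1::real) \<le> norm (utility T \<nu> r) \<and>
        norm (utility T \<nu> r) \<le> 1 / spectral_radius (lower_bounding_matrix T) * norm (1::real)) at_top"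
      using eventually_ge_at_top[of 1] by eventually_elim (use bounds pos in force)
  qed (use assms(5) in simp)
qed

end
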